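(* Let $f:X\to Y$ be a pointed map between connected CW complexes and let $n\ge 1$. Let $\mathrm{map}_f(X,Y)$ be the connected component of $f$ in the space $\mathrm{map}(X,Y)$ of (unpointed) maps from $X$ to $Y$ with the compact-open topology, and let $\tilde{ev}:\mathrm{map}_f(X,Y)\times X\to Y$ be the evaluation map $\tilde{ev}(h,x)=h(x)$. Then $$\mathcal{G}_n(Y,X;f)=\mathrm{Im}\bigl(\pi_n(\tilde{ev}):\pi_n(\mathrm{map}_f(X,Y)\times X)\to \pi_n(Y)\bigr).$$
   Context: The base point of $\mathrm{map}_f(X,Y)\times X$ is $(f,* )$. Maps and homotopies are pointed. For spaces $B,X$ let $i_X:X\to B\times X$, $i_X(x)=( *,x)$, and let $p_B:B\times X\to B$ be the projection; a section is a map $s:B\to B\times X$ with $p_B\circ s\simeq \mathrm{id}_B$. For a pointed map $f:X\to Y$, the $n$th relaxed evaluation subgroup $\mathcal{G}_n(Y,X;f)$ is the set of all $a\in\pi_n(Y)$ for which there exist a section $s:S^n\to S^n\times X$ and a map $F:S^n\times X\to Y$ such that $F\circ s\simeq a$ and $F\circ i_X\simeq f$. *)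

theory Defs
  imports "HOL-Analysis.Analysis"
begin

section \<open>CW complexes\<close>

definition disk :: "nat \<Rightarrow> (nat \<Rightarrow> real) topology" where
  "disk n = subtopology (Euclidean_space n) {x. (\<Sum>i<n. x i ^ 2) \<le> 1}"

definition disk_interior :: "nat \<Rightarrow> (nat \<Rightarrow> real) set" where
  "disk_interior n = {x \<in> topspace (disk n). (\<Sum>i<n. x i ^ 2) < 1}"

definition disk_boundary :: "nat \<Rightarrow> (nat \<Rightarrow> real) set" where
  "disk_boundary n = {x \<in> topspace (disk n). (\<Sum>i<n. x i ^ 2) = 1}"

text \<open>A cell is given by its dimension and its characteristic map. Since distinct cells of a
  CW structure are disjoint and nonempty, no separate index type is needed.\<close>

type_synonym 'a cell = "nat \<times> ((nat \<Rightarrow> real) \<Rightarrow> 'a)"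

definition open_cell :: "'a cell \<Rightarrow> 'a set" where
  "open_cell c = snd c ` disk_interior (fst c)"

definition CW_structure :: "'a topology \<Rightarrow> 'a cell set \<Rightarrow> bool" where
  "CW_structure X E \<longleftrightarrow>
     Hausdorff_space X \<and>
     (\<forall>(n, \<phi>) \<in> E. continuous_map (disk n) X \<phi> \<and>
        embedding_map (subtopology (disk n) (disk_interior n)) X \<phi>) \<and>
     pairwise (\<lambda>c d. disjnt (open_cell c) (open_cell d)) E \<and>
     (\<Union>c\<in>E. open_cell c) = topspace X \<and>
     (\<forall>(n, \<phi>) \<in> E. \<exists>D \<subseteq> E. finite D \<and> (\<forall>d\<in>D. fst d < n) \<and>
        \<phi> ` disk_boundary n \<subseteq> (\<Union>d\<in>D. open_cell d)) \<and>
     (\<forall>A \<subseteq> topspace X.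
        (\<forall>c\<in>E. closedin X (A \<inter> X closure_of open_cell c)) \<longrightarrow> closedin X A)"

definition CW_complex :: "'a topology \<Rightarrow> bool" where
  "CW_complex X \<longleftrightarrow> (\<exists>E. CW_structure X E)"

section \<open>Pointed maps and homotopy groups\<close>

definition pointed_map ::
  "'a topology \<Rightarrow> 'a \<Rightarrow> 'b topology \<Rightarrow> 'b \<Rightarrow> ('a \<Rightarrow> 'b) \<Rightarrow> bool" where
  "pointed_map X x0 Y y0 f \<longleftrightarrow> continuous_map X Y f \<and> f x0 = y0"

definition pointed_homotopic ::
  "'a topology \<Rightarrow> 'a \<Rightarrow> 'b topology \<Rightarrow> 'b \<Rightarrow> ('a \<Rightarrow> 'b) \<Rightarrow> ('a \<Rightarrow> 'b) \<Rightarrow> bool" where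
  "pointed_homotopic X x0 Y y0 = homotopic_with (\<lambda>h. h x0 = y0) X Y"

definition sphere_point :: "nat \<Rightarrow> real" where
  "sphere_point = (\<lambda>i. if i = 0 then 1 else 0)"

text \<open>The underlying set of the \<open>n\<close>th homotopy group: its elements are the pointed homotopy
  classes of pointed maps from the \<open>n\<close>-sphere.\<close>

definition homotopy_group ::
  "nat \<Rightarrow> 'b topology \<Rightarrow> 'b \<Rightarrow> ((nat \<Rightarrow> real) \<Rightarrow> 'b) set set" where
  "homotopy_group n Y y0 =
     {\<alpha>. pointed_map (nsphere n) sphere_point Y y0 \<alpha>} //
     {(\<alpha>, \<beta>). pointed_homotopic (nsphere n) sphere_point Y y0 \<alpha> \<beta>}"

text \<open>The map induced on homotopy groups by a function \<open>g\<close> into \<open>(Y, y0)\<close> sends the class of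
  \<open>\<alpha>\<close> to the class of \<open>g \<circ> \<alpha>\<close>. Continuity of \<open>g\<close> is not required: it is enough that \<open>g\<close> is
  continuous along maps from compact Hausdorff spaces. This matters for the evaluation map
  below, which need not be continuous for the product topology if \<open>X\<close> is not locally
  compact.\<close>

definition homotopy_group_map ::
  "nat \<Rightarrow> 'b topology \<Rightarrow> 'b \<Rightarrow> ('a \<Rightarrow> 'b) \<Rightarrow>
    ((nat \<Rightarrow> real) \<Rightarrow> 'a) set \<Rightarrow> ((nat \<Rightarrow> real) \<Rightarrow> 'b) set" where
  "homotopy_group_map n Y y0 g a =
     (\<Union>\<alpha>\<in>a. {\<beta>. pointed_homotopic (nsphere n) sphere_point Y y0 (g \<circ> \<alpha>) \<beta>})"

section \<open>Mapping spaces\<close>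

text \<open>Points of the mapping space are functions that are \<open>undefined\<close> outside \<open>topspace X\<close>, so
  that each continuous map on \<open>topspace X\<close> is represented exactly once.\<close>

definition map_set :: "'a topology \<Rightarrow> 'b topology \<Rightarrow> ('a \<Rightarrow> 'b) set" where
  "map_set X Y = {h \<in> extensional (topspace X). continuous_map X Y h}"

definition map_space :: "'a topology \<Rightarrow> 'b topology \<Rightarrow> ('a \<Rightarrow> 'b) topology" where
  "map_space X Y = topology_generated_by
     {{h \<in> map_set X Y. h ` K \<subseteq> U} | K U. compactin X K \<and> openin Y U}"

definition map_component ::
  "'a topology \<Rightarrow> 'b topology \<Rightarrow> ('a \<Rightarrow> 'b) \<Rightarrow> ('a \<Rightarrow> 'b) topology" where
  "map_component X Y f = subtopology (map_space X Y)
     (connected_component_of_set (map_space X Y) (restrict f (topspace X)))"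

definition evaluation :: "('a \<Rightarrow> 'b) \<times> 'a \<Rightarrow> 'b" where
  "evaluation = (\<lambda>(h, x). h x)"

section \<open>Relaxed evaluation subgroups\<close>

definition pointed_section ::
  "'b topology \<Rightarrow> 'b \<Rightarrow> 'a topology \<Rightarrow> 'a \<Rightarrow> ('b \<Rightarrow> 'b \<times> 'a) \<Rightarrow> bool" where
  "pointed_section B b0 X x0 s \<longleftrightarrow>
     pointed_map B b0 (prod_topology B X) (b0, x0) s \<and>
     pointed_homotopic B b0 B b0 (fst \<circ> s) id"

definition relaxed_evaluation_subgroup ::
  "nat \<Rightarrow> 'b topology \<Rightarrow> 'b \<Rightarrow> 'a topology \<Rightarrow> 'a \<Rightarrow> ('a \<Rightarrow> 'b) \<Rightarrow>
    ((nat \<Rightarrow> real) \<Rightarrow> 'b) set set" where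
  "relaxed_evaluation_subgroup n Y y0 X x0 f =
     {a \<in> homotopy_group n Y y0.
        \<exists>s F. pointed_section (nsphere n) sphere_point X x0 s \<and>
          pointed_map (prod_topology (nsphere n) X) (sphere_point, x0) Y y0 F \<and>
          F \<circ> s \<in> a \<and>
          pointed_homotopic X x0 Y y0 (F \<circ> (\<lambda>x. (sphere_point, x))) f}"

end

theory Submission
  imports Defs
begin

text \<open>A map \<open>\<alpha> = (\<alpha>\<^sub>1, \<alpha>\<^sub>2)\<close> from the sphere to \<open>map\<^sub>f(X, Y) \<times> X\<close> is the same thing as a map
  \<open>F(b, x) = \<alpha>\<^sub>1(b)(x)\<close> on \<open>S\<^sup>n \<times> X\<close> together with the strict section \<open>s(b) = (b, \<alpha>\<^sub>2(b))\<close>, and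
  then \<open>F \<circ> s\<close> is the evaluation of \<open>\<alpha>\<close>. Under this correspondence the base point condition on
  \<open>\<alpha>\<^sub>1\<close> says that \<open>F\<close> restricts to \<open>f\<close> on the slice \<open>{*} \<times> X\<close>. So the theorem says that two
  homotopies in the definition of the relaxed evaluation subgroup can be made equalities
  without changing the class of \<open>F \<circ> s\<close>.

  The homotopy between \<open>F\<close> on the slice and \<open>f\<close> is removed by the homotopy extension property of
  the slice in \<open>S\<^sup>n \<times> X\<close> (\<open>homotopy_extension_sphere_slice\<close>). It comes from a deformation of
  the sphere near its base point (\<open>sphere_pushing_homotopy\<close>), and it keeps base points fixed because the given homotopy does.
  The homotopy between \<open>fst \<circ> s\<close> and the identity is removed by moving the first component of
  \<open>s\<close> along it while the second component stays put. The curried map then lands in the component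
  of \<open>f\<close> because \<open>S\<^sup>n\<close> is connected for \<open>n \<ge> 1\<close>.

  What remains is the exponential law. Currying is continuous for all spaces
  (\<open>continuous_map_curry\<close>). Uncurrying (\<open>continuous_map_uncurry\<close>) uses that a CW complex is a
  Hausdorff k-space, so that its product with a compact Hausdorff space is again a k-space and
  continuity need only be tested on compact subsets of \<open>X\<close>. Applied to \<open>S\<^sup>n\<close> it produces the map
  \<open>F\<close>; applied to \<open>[0, 1] \<times> S\<^sup>n\<close> it shows that evaluation respects homotopy classes.\<close>

section \<open>The exponential law for the compact-open topology\<close>

lemma topspace_map_space: "topspace (map_space X Y) = map_set X Y"
proof -
  \<comment> \<open>The whole mapping set is the subbasic set for \<open>K = {}\<close>.\<close>
  have "map_set X Y \<in> {{h \<in> map_set X Y. h ` K \<subseteq> U} | K U. compactin X K \<and> openin Y U}"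
    by (rule CollectI, rule exI[of _ "{}"], rule exI[of _ "{}"]) simp
  then show ?thesis
    unfolding map_space_def topology_generated_by_topspace by blast
qed

text \<open>The classical argument that evaluation is continuous on a locally compact Hausdorff space,
  carried out in \<open>K\<close>: near \<open>x\<close> the map \<open>H c\<close> sends a compact neighbourhood \<open>N\<close> into \<open>V\<close>, and
  sending \<open>N\<close> into \<open>V\<close> is an open condition on \<open>H c\<close>.\<close>

lemma evaluation_continuous_on_compact:
  assumes H: "continuous_map C (map_space X Y) H"
    and K: "compactin X K" and "Hausdorff_space X"
  shows "continuous_map (prod_topology C (subtopology X K)) Y (\<lambda>(c, x). H c x)"
proof -
  let ?Z = "subtopology X K"
  have Ksub: "K \<subseteq> topspace X" and topZ: "topspace ?Z = K"
    using K compactin_subset_topspace by fastforce+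
  have "compact_space ?Z"
    using K by (simp add: compact_space_subtopology)
  moreover from this have "regular_space ?Z"
    by (simp add: Hausdorff_space_subtopology assms(3) compact_Hausdorff_imp_regular_space)
  ultimately have nbhd: "neighbourhood_base_of (closedin ?Z) ?Z" and cZ: "compact_space ?Z"
    by (simp_all add: neighbourhood_base_of_closedin)
  have Hmap: "H c \<in> map_set X Y" if "c \<in> topspace C" for c
    using H that topspace_map_space by (metis continuous_map_image_subset_topspace image_subset_iff)
  have Hc: "continuous_map X Y (H c)" if "c \<in> topspace C" for c
    using Hmap[OF that] by (simp add: map_set_def)
  show ?thesis
    unfolding continuous_map
  proof (intro conjI allI impI)
    show "(\<lambda>(c, x). H c x) ` topspace (prod_topology C ?Z) \<subseteq> topspace Y"
      using Hc Ksub topZ by (auto simp: continuous_map_def Pi_iff)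
  next
    fix V assume V: "openin Y V"
    let ?P = "{p \<in> topspace (prod_topology C ?Z). (case p of (c, x) \<Rightarrow> H c x) \<in> V}"
    show "openin (prod_topology C ?Z) ?P"
    proof (subst openin_subopen, clarify)
      fix c x assume "(c, x) \<in> topspace (prod_topology C ?Z)" and HV: "H c x \<in> V"
      then have c: "c \<in> topspace C" and x: "x \<in> K" by (auto simp: topZ)
      have "openin ?Z {z \<in> topspace ?Z. H c z \<in> V}"
        using Hc[OF c] V continuous_map_from_subtopology openin_continuous_map_preimage by blast
      moreover have "x \<in> {z \<in> topspace ?Z. H c z \<in> V}"
        using x HV topZ by auto
      ultimately obtain U N where U: "openin ?Z U" and N: "closedin ?Z N"
        and xU: "x \<in> U" and UN: "U \<subseteq> N" and NV: "N \<subseteq> {z \<in> topspace ?Z. H c z \<in> V}"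
        using nbhd unfolding neighbourhood_base_of by meson
      have "compactin X N"
        using N cZ closedin_compact_space compactin_subtopology by blast
      then have "openin (map_space X Y) {h \<in> map_set X Y. h ` N \<subseteq> V}"
        unfolding map_space_def using V by (intro topology_generated_by_Basis) blast
      then have W: "openin C {c' \<in> topspace C. H c' \<in> {h \<in> map_set X Y. h ` N \<subseteq> V}}"
        using H openin_continuous_map_preimage by blast
      let ?W = "{c' \<in> topspace C. H c' \<in> {h \<in> map_set X Y. h ` N \<subseteq> V}}"
      have "openin (prod_topology C ?Z) (?W \<times> U)"
        using W U by (simp add: openin_prod_Times_iff)
      moreover have "(c, x) \<in> ?W \<times> U"
        using c xU NV Hmap by auto
      moreover have "?W \<times> U \<subseteq> ?P"
        using UN NV by auto
      ultimately show "\<exists>T. openin (prod_topology C ?Z) T \<and> (c, x) \<in> T \<and> T \<subseteq> ?P"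
        by blast
    qed
  qed
qed

text \<open>Evaluation itself may be discontinuous when \<open>X\<close> is not locally compact, but \<open>C \<times> X\<close> is a
  k-space, and each of its compact subsets lies in \<open>C \<times> K\<close> for the compact projection \<open>K\<close> to \<open>X\<close>.\<close>

lemma continuous_map_uncurry:
  assumes H: "continuous_map C (map_space X Y) H"
    and C: "compact_space C" "Hausdorff_space C"
    and X: "k_space X" "Hausdorff_space X"
  shows "continuous_map (prod_topology C X) Y (\<lambda>(c, x). H c x)"
proof (rule continuous_map_from_k_space)
  show "k_space (prod_topology C X)"
    using C X by (simp add: compact_imp_locally_compact_space k_space_prod_topology_left)
next
  fix L assume L: "compactin (prod_topology C X) L"
  then have K: "compactin X (snd ` L)"
    using continuous_map_snd image_compactin by blast
  have "subtopology (prod_topology C X) (topspace C \<times> snd ` L)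
      = prod_topology C (subtopology X (snd ` L))"
    by (simp add: prod_topology_subtopology)
  then have "continuous_map (subtopology (prod_topology C X) (topspace C \<times> snd ` L)) Y (\<lambda>(c, x). H c x)"
    using evaluation_continuous_on_compact[OF H K X(2)] by simp
  moreover have "L \<subseteq> topspace C \<times> snd ` L"
    using compactin_subset_topspace[OF L] by force
  ultimately show "continuous_map (subtopology (prod_topology C X) L) Y (\<lambda>(c, x). H c x)"
    using continuous_map_from_subtopology_mono by blast
qed

text \<open>The tube lemma, in the form that the projection along a compact space is a closed map, gives
  the openness of the set of all \<open>c\<close> with \<open>F({c} \<times> K) \<subseteq> U\<close>.\<close>

lemma continuous_map_curry:
  assumes F: "continuous_map (prod_topology C X) Y F"
  shows "continuous_map C (map_space X Y) (\<lambda>c. restrict (\<lambda>x. F (c, x)) (topspace X))"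
proof -
  let ?G = "\<lambda>c. restrict (\<lambda>x. F (c, x)) (topspace X)"
  have G: "?G c \<in> map_set X Y" if "c \<in> topspace C" for c
  proof -
    have "continuous_map X Y (F \<circ> Pair c)"
      using F that by (rule continuous_map_o_Pair)
    then have "continuous_map X Y (?G c)"
      by (rule continuous_map_eq) simp
    then show ?thesis by (simp add: map_set_def)
  qed
  show ?thesis
    unfolding map_space_def
  proof (rule continuous_on_generated_topo)
    show "?G ` topspace C \<subseteq> \<Union>{{h \<in> map_set X Y. h ` K \<subseteq> U} | K U. compactin X K \<and> openin Y U}"
      using G topspace_map_space[of X Y]
      unfolding map_space_def topology_generated_by_topspace by blast
  next
    fix S assume "S \<in> {{h \<in> map_set X Y. h ` K \<subseteq> U} | K U. compactin X K \<and> openin Y U}"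
    then obtain K U where S: "S = {h \<in> map_set X Y. h ` K \<subseteq> U}"
      and K: "compactin X K" and U: "openin Y U" by blast
    let ?Z = "subtopology X K"
    have Ks: "K \<subseteq> topspace X" and topZ: "topspace ?Z = K"
      using K compactin_subset_topspace by fastforce+
    have FZ: "continuous_map (prod_topology C ?Z) Y F"
      using F by (simp add: continuous_map_from_subtopology prod_topology_subtopology)
    let ?B = "{p \<in> topspace (prod_topology C ?Z). F p \<in> topspace Y - U}"
    have "closedin (prod_topology C ?Z) ?B"
      using FZ U closedin_continuous_map_preimage by blast
    moreover have "closed_map (prod_topology C ?Z) C fst"
      using K by (simp add: closed_map_fst compact_space_subtopology)
    ultimately have "closedin C (fst ` ?B)"
      by (simp add: closed_map_def)
    moreover have "?G -` S \<inter> topspace C = topspace C - fst ` ?B"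
    proof (intro set_eqI iffI)
      fix c assume "c \<in> ?G -` S \<inter> topspace C"
      then show "c \<in> topspace C - fst ` ?B"
        using Ks by (auto simp: S topZ image_subset_iff subset_iff)
    next
      fix c assume c: "c \<in> topspace C - fst ` ?B"
      have "F (c, x) \<in> U" if "x \<in> K" for x
      proof (rule ccontr)
        assume "F (c, x) \<notin> U"
        moreover have "F (c, x) \<in> topspace Y"
          using F c Ks that by (auto simp: continuous_map_def Pi_iff)
        ultimately have "(c, x) \<in> ?B" using c that topZ by auto
        then show False using c by force
      qed
      then show "c \<in> ?G -` S \<inter> topspace C"
        using G c Ks by (auto simp: S)
    qed
    ultimately show "openin C (?G -` S \<inter> topspace C)"
      by (simp add: openin_diff)
  qed
qed

section \<open>CW complexes are k-spaces\<close>

lemma compact_space_disk: "compact_space (disk n)"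
proof -
  let ?D = "{x. (\<Sum>i<n. x i ^ 2) \<le> (1::real)} \<inter> {x. \<forall>i\<ge>n. x i = 0}"
  have "closed {x :: nat \<Rightarrow> real. (\<Sum>i<n. x i ^ 2) \<le> 1}"
    by (intro closed_Collect_le continuous_intros continuous_on_coordinatewise_then_product) auto
  moreover have "closed {x :: nat \<Rightarrow> real. \<forall>i\<ge>n. x i = 0}"
    by (intro closed_Collect_all closed_Collect_imp closed_Collect_eq continuous_intros) auto
  ultimately have "closed ?D" by (rule closed_Int)
  then have cl: "closedin (powertop_real UNIV) ?D"
    by (simp add: euclidean_product_topology)
  have box: "compactin (powertop_real UNIV) (PiE UNIV (\<lambda>_. {-1..1}))"
    by (simp add: compactin_PiE)
  have "?D \<subseteq> PiE UNIV (\<lambda>_. {-1..1})"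
  proof (intro subsetI PiE_I)
    fix x :: "nat \<Rightarrow> real" and i
    assume "x \<in> ?D"
    then have s: "(\<Sum>i<n. x i ^ 2) \<le> 1" and z: "\<forall>i\<ge>n. x i = 0" by auto
    have "(x i)^2 \<le> 1"
    proof (cases "i < n")
      case True
      then have "(x i)^2 \<le> (\<Sum>i<n. x i ^ 2)" by (intro member_le_sum) auto
      with s show ?thesis by linarith
    qed (simp add: z)
    then show "x i \<in> {-1..1}" by (simp add: abs_square_le_1 abs_le_iff)
  qed auto
  then have "compactin (powertop_real UNIV) ?D"
    by (rule closed_compactin[OF box _ cl])
  then show ?thesis
    by (simp add: disk_def Euclidean_space_def subtopology_subtopology Int_commute compact_space_subtopology)
qed

text \<open>The closure of a cell is compact, being a closed subset of the image of a disk, so the weak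
  topology is already determined by compact subsets.\<close>

lemma CW_complex_Hausdorff_k_space:
  assumes "CW_complex X"
  shows "Hausdorff_space X" "k_space X"
proof -
  obtain E where "CW_structure X E" using assms by (auto simp: CW_complex_def)
  then have haus: "Hausdorff_space X"
    and cont: "\<And>n \<phi>. (n, \<phi>) \<in> E \<Longrightarrow> continuous_map (disk n) X \<phi>"
    and weak: "\<And>A. A \<subseteq> topspace X \<Longrightarrow> (\<forall>c\<in>E. closedin X (A \<inter> X closure_of open_cell c)) \<Longrightarrow> closedin X A"
    unfolding CW_structure_def by auto
  show "Hausdorff_space X" by fact
  have compact_cell: "compactin X (X closure_of open_cell c)" if "c \<in> E" for c
  proof -
    obtain n \<phi> where c: "c = (n, \<phi>)" by fastforce
    let ?K = "\<phi> ` topspace (disk n)"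
    have "compactin X ?K"
      using cont that c compact_space_disk image_compactin compact_space_def by blast
    moreover have "open_cell c \<subseteq> ?K"
      by (auto simp: open_cell_def c disk_interior_def)
    ultimately show ?thesis
      using haus by (meson closed_compactin closedin_closure_of closure_of_minimal compactin_imp_closedin)
  qed
  show "k_space X"
    unfolding k_space
  proof (intro allI impI)
    fix A assume "A \<subseteq> topspace X \<and> (\<forall>K. compactin X K \<longrightarrow> closedin (subtopology X K) (K \<inter> A))"
    then have A: "A \<subseteq> topspace X" and cl: "\<And>K. compactin X K \<Longrightarrow> closedin (subtopology X K) (K \<inter> A)"
      by auto
    show "closedin X A"
    proof (rule weak[OF A], rule ballI)
      fix c assume "c \<in> E"
      then show "closedin X (A \<inter> X closure_of open_cell c)"
        using cl compact_cell haus
        by (metis closedin_closed_subtopology compactin_imp_closedin inf_commute)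
    qed
  qed
qed

section \<open>Spheres\<close>

lemma compact_space_nsphere: "compact_space (nsphere n)"
proof -
  have eq: "nsphere n = subtopology (disk (Suc n)) {x. (\<Sum>i\<le>n. x i ^ 2) = 1}"
    unfolding nsphere_def disk_def subtopology_subtopology
    by (rule arg_cong[where f = "subtopology _"]) (auto simp: lessThan_Suc_atMost)
  have proj: "continuous_map (disk (Suc n)) euclideanreal (\<lambda>x. x k)" for k
    unfolding disk_def Euclidean_space_def
    by (intro continuous_map_from_subtopology continuous_map_product_projection) simp
  have "closedin (disk (Suc n)) {x \<in> topspace (disk (Suc n)). (\<Sum>i\<le>n. x i ^ 2) \<in> {1}}"
    by (intro closedin_continuous_map_preimage[where Y = euclideanreal] continuous_intros proj) auto
  then have "compactin (disk (Suc n)) {x \<in> topspace (disk (Suc n)). (\<Sum>i\<le>n. x i ^ 2) \<in> {1}}"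
    by (simp add: closedin_compact_space compact_space_disk)
  then have "compact_space (subtopology (disk (Suc n)) (topspace (disk (Suc n)) \<inter> {x. (\<Sum>i\<le>n. x i ^ 2) = 1}))"
    by (intro compact_space_subtopology) (simp add: Int_def)
  then show ?thesis
    unfolding eq using subtopology_restrict by metis
qed

lemma Hausdorff_space_nsphere: "Hausdorff_space (nsphere n)"
  by (simp add: nsphere_def Hausdorff_space_subtopology Hausdorff_Euclidean_space)

lemma sphere_point_in_nsphere [simp]: "sphere_point \<in> topspace (nsphere n)"
  unfolding sphere_point_def by (rule in_topspace_nsphere)

text \<open>The two hemispheres with respect to the last coordinate are contractible, and for
  \<open>n \<ge> 1\<close> the base point lies on the equator between them.\<close>

lemma connected_space_nsphere:
  assumes "n \<ge> 1"
  shows "connected_space (nsphere n)"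
proof -
  have "connectedin (nsphere n) (topspace (nsphere n) \<inter> {x. x n \<ge> 0})"
    using contractible_imp_connected_space[OF contractible_space_upper_hemisphere[of n n]]
    by (metis connectedin_def connectedin_topspace inf.cobounded1 order_refl subtopology_restrict)
  moreover have "connectedin (nsphere n) (topspace (nsphere n) \<inter> {x. x n \<le> 0})"
    using contractible_imp_connected_space[OF contractible_space_lower_hemisphere[of n n]]
    by (metis connectedin_def connectedin_topspace inf.cobounded1 order_refl subtopology_restrict)
  moreover have "sphere_point n = 0"
    using assms by (simp add: sphere_point_def)
  then have "sphere_point \<in> (topspace (nsphere n) \<inter> {x. x n \<ge> 0}) \<inter> (topspace (nsphere n) \<inter> {x. x n \<le> 0})"
    by simp
  ultimately have "connectedin (nsphere n) ((topspace (nsphere n) \<inter> {x. x n \<ge> 0}) \<union> (topspace (nsphere n) \<inter> {x. x n \<le> 0}))"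
    by (intro connectedin_Un) blast+
  moreover have "(topspace (nsphere n) \<inter> {x. x n \<ge> 0}) \<union> (topspace (nsphere n) \<inter> {x. x n \<le> 0}) = topspace (nsphere n)"
    by force
  ultimately show ?thesis
    by (simp add: connectedin_topspace)
qed

text \<open>A deformation of the sphere that ends by collapsing the cap \<open>{b. b\<^sub>0 \<ge> 1/2}\<close> to the base point:
  at time \<open>t\<close> the coordinates other than \<open>b\<^sub>0\<close> are scaled by \<open>max 0 (1 - 2 t b\<^sub>0)\<close> on the half where
  \<open>b\<^sub>0\<close> is positive, and the result is normalised. The scaling factor vanishes only where \<open>b\<^sub>0\<close>
  is positive, so the vector to be normalised is never zero. The third property makes room for a
  second homotopy: on the region \<open>2 t b\<^sub>0 \<ge> 1\<close> a map composed with \<open>r\<close> no longer depends on \<open>b\<close>.\<close>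

lemma sphere_pushing_homotopy:
  obtains r :: "real \<times> (nat \<Rightarrow> real) \<Rightarrow> nat \<Rightarrow> real" where
    "continuous_map (prod_topology (top_of_set {0..1}) (nsphere n)) (nsphere n) r"
    "\<And>b. b \<in> topspace (nsphere n) \<Longrightarrow> r (0, b) = b"
    "\<And>t b. \<lbrakk>t \<in> {0..1}; b \<in> topspace (nsphere n); 2 * t * b 0 \<ge> 1\<rbrakk> \<Longrightarrow> r (t, b) = sphere_point"
    "\<And>t. r (t, sphere_point) = sphere_point"
proof -
  define \<mu> :: "real \<times> (nat \<Rightarrow> real) \<Rightarrow> real"
    where "\<mu> \<equiv> \<lambda>(t, b). max 0 (1 - t * max 0 (2 * b 0))"
  define w :: "real \<times> (nat \<Rightarrow> real) \<Rightarrow> nat \<Rightarrow> real"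
    where "w \<equiv> \<lambda>p i. (if i = 0 then 1 else \<mu> p) * snd p i"
  define N where "N \<equiv> \<lambda>p. \<Sum>i\<le>n. (w p i)\<^sup>2"
  define r where "r \<equiv> \<lambda>p i. w p i / sqrt (N p)"
  let ?T = "prod_topology (top_of_set {0..1::real}) (nsphere n)"
  have sph: "b \<in> topspace (nsphere n) \<longleftrightarrow> (\<Sum>i\<le>n. (b i)\<^sup>2) = 1 \<and> (\<forall>i>n. b i = 0)" for b
    by (simp add: nsphere)
  have Nnz: "N (t, b) \<noteq> 0" if b: "b \<in> topspace (nsphere n)" for t b
  proof
    assume "N (t, b) = 0"
    then have z: "w (t, b) i = 0" if "i \<le> n" for i
      using that by (simp add: N_def sum_nonneg_eq_0_iff)
    from z[of 0] have b0: "b 0 = 0" by (simp add: w_def)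
    then have "b i = 0" if "i \<le> n" for i
      using z[OF that] by (auto simp: w_def \<mu>_def split: if_splits)
    then show False using b by (simp add: sph)
  qed
  have Nge: "N p \<ge> 0" for p by (simp add: N_def sum_nonneg)
  have t: "continuous_map ?T euclideanreal fst"
    using continuous_map_fst continuous_map_in_subtopology by blast
  have p: "continuous_map ?T euclideanreal (\<lambda>p. snd p i)" for i
    using continuous_map_compose[OF continuous_map_snd continuous_map_nsphere_projection]
    by (simp add: o_def)
  have m: "continuous_map ?T euclideanreal \<mu>"
    unfolding \<mu>_def case_prod_unfold by (intro continuous_intros t p) 
  have w: "continuous_map ?T euclideanreal (\<lambda>p. w p i)" for i
    unfolding w_def by (cases "i = 0") (auto intro!: continuous_intros m p)
  have "continuous_map ?T euclideanreal N"
    unfolding N_def by (intro continuous_intros w) auto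
  then have ri: "continuous_map ?T euclideanreal (\<lambda>p. r p i)" for i
    unfolding r_def using Nnz by (intro continuous_intros w) auto
  have "(\<Sum>i\<le>n. (r p i)\<^sup>2) = 1 \<and> (\<forall>i>n. r p i = 0)" if p: "p \<in> topspace ?T" for p
  proof -
    obtain t b where pb: "p = (t, b)" "b \<in> topspace (nsphere n)" using p by (cases p) auto
    have "(\<Sum>i\<le>n. (r p i)\<^sup>2) = N p / N p"
      using Nge[of p] by (simp add: r_def power_divide N_def flip: sum_divide_distrib)
    then show ?thesis using Nnz[OF pb(2)] pb by (auto simp: r_def w_def sph)
  qed
  then have cont: "continuous_map ?T (nsphere n) r"
    using ri by (auto simp: nsphere continuous_map_in_subtopology continuous_map_componentwise_UNIV)
  have r0: "r (0, b) = b" if "b \<in> topspace (nsphere n)" for b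
  proof -
    have "w (0, b) = b" by (auto simp: w_def \<mu>_def)
    then show ?thesis using that by (simp add: r_def N_def sph)
  qed
  have sp1: "(\<Sum>i\<le>n. (sphere_point i)\<^sup>2) = 1"
    using sphere_point_in_nsphere[of n] by (simp add: sph del: sphere_point_in_nsphere)
  have r1: "r (t, b) = sphere_point"
    if "b \<in> topspace (nsphere n)" "2 * t * b 0 \<ge> 1" "t \<in> {0..1}" for t b
  proof -
    have pos: "b 0 > 0"
    proof (rule ccontr)
      assume "\<not> b 0 > 0"
      then have "t * b 0 \<le> 0" using that(3) by (simp add: mult_nonneg_nonpos)
      then show False using that(2) by simp
    qed
    then have mu: "\<mu> (t, b) = 0" using that(2) by (simp add: \<mu>_def max_def mult.assoc mult.left_commute)
    then have w: "w (t, b) = (\<lambda>i. b 0 * sphere_point i)" by (auto simp: w_def sphere_point_def)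
    have "N (t, b) = (b 0)\<^sup>2"
      by (simp add: N_def w power_mult_distrib sp1 flip: sum_distrib_left)
    then show ?thesis using pos by (auto simp: r_def w)
  qed
  have r2: "r (t, sphere_point) = sphere_point" for t
  proof -
    have "w (t, sphere_point) = sphere_point" by (auto simp: w_def sphere_point_def)
    then show ?thesis by (simp add: r_def N_def sp1)
  qed
  show thesis by (rule that[OF cont r0 r1 r2])
qed

section \<open>Pointed homotopies\<close>

text \<open>It is enough to prescribe the ends of a homotopy on the space itself; this disposes of the
  arbitrary values of HOL functions outside it.\<close>

lemma pointed_homotopic_iff:
  assumes "x0 \<in> topspace X"
  shows "pointed_homotopic X x0 Y y0 p q \<longleftrightarrow>
    (\<exists>h. continuous_map (prod_topology (top_of_set {0..1::real}) X) Y h \<and>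
      (\<forall>x\<in>topspace X. h (0, x) = p x) \<and> (\<forall>x\<in>topspace X. h (1, x) = q x) \<and>
      (\<forall>t\<in>{0..1}. h (t, x0) = y0))"
  unfolding pointed_homotopic_def by (rule homotopic_with) (use assms in auto)

lemma pointed_homotopic_sym:
  "pointed_homotopic X x0 Y y0 p q \<Longrightarrow> pointed_homotopic X x0 Y y0 q p"
  unfolding pointed_homotopic_def by (rule homotopic_with_symD)

lemma pointed_homotopic_trans:
  "\<lbrakk>pointed_homotopic X x0 Y y0 p q; pointed_homotopic X x0 Y y0 q r\<rbrakk>
    \<Longrightarrow> pointed_homotopic X x0 Y y0 p r"
  unfolding pointed_homotopic_def by (rule homotopic_with_trans)

lemma pointed_homotopic_refl:
  "pointed_map X x0 Y y0 p \<Longrightarrow> pointed_homotopic X x0 Y y0 p p"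
  by (simp add: pointed_homotopic_def pointed_map_def)

lemma pointed_homotopic_equal:
  "\<lbrakk>pointed_map X x0 Y y0 p; x0 \<in> topspace X; \<And>x. x \<in> topspace X \<Longrightarrow> p x = q x\<rbrakk>
    \<Longrightarrow> pointed_homotopic X x0 Y y0 p q"
  unfolding pointed_homotopic_def pointed_map_def by (rule homotopic_with_equal) auto

lemma pointed_homotopic_imp_pointed_map:
  "pointed_homotopic X x0 Y y0 p q \<Longrightarrow> pointed_map X x0 Y y0 p \<and> pointed_map X x0 Y y0 q"
  unfolding pointed_homotopic_def pointed_map_def
  using homotopic_with_imp_continuous_maps homotopic_with_imp_property by blast

lemma pointed_map_compose:
  "\<lbrakk>pointed_map X x0 Y y0 p; pointed_map Y y0 Z z0 q\<rbrakk> \<Longrightarrow> pointed_map X x0 Z z0 (q \<circ> p)"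
  by (auto simp: pointed_map_def intro: continuous_map_compose)

lemma pointed_homotopic_compose_left:
  assumes "pointed_homotopic X x0 Y y0 p q" "pointed_map Y y0 Z z0 k"
  shows "pointed_homotopic X x0 Z z0 (k \<circ> p) (k \<circ> q)"
  using assms unfolding pointed_homotopic_def pointed_map_def
  by (elim homotopic_with_compose_continuous_map_left conjE) auto

lemma pointed_homotopic_compose_right:
  assumes "pointed_homotopic Y y0 Z z0 p q" "pointed_map X x0 Y y0 k"
  shows "pointed_homotopic X x0 Z z0 (p \<circ> k) (q \<circ> k)"
  using assms unfolding pointed_homotopic_def pointed_map_def
  by (elim homotopic_with_compose_continuous_map_right conjE) auto

section \<open>Extending a homotopy from a slice\<close>

text \<open>While the deformation \<open>r\<close> collapses the region \<open>2 t b\<^sub>0 \<ge> 1\<close>, the homotopy \<open>h\<close> from \<open>F\<close> on the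
  slice to \<open>f\<close> is spread over that region, with time parameter \<open>2 t b\<^sub>0 - 1\<close>. On the common
  boundary \<open>2 t b\<^sub>0 = 1\<close> both parts agree with \<open>F\<close> on the slice; at the base point, where
  \<open>b\<^sub>0 = 1\<close>, the parameter reaches \<open>1\<close> for \<open>t = 1\<close>.\<close>

lemma homotopy_extension_sphere_slice:
  assumes F: "pointed_map (prod_topology (nsphere n) X) (sphere_point, x0) Y y0 F"
    and hom: "pointed_homotopic X x0 Y y0 (F \<circ> (\<lambda>x. (sphere_point, x))) f"
    and x0: "x0 \<in> topspace X"
  obtains G where
    "pointed_homotopic (prod_topology (nsphere n) X) (sphere_point, x0) Y y0 F G"
    "\<And>x. x \<in> topspace X \<Longrightarrow> G (sphere_point, x) = f x"
proof -
  let ?I = "top_of_set {0..1::real}" and ?S = "nsphere n"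
  let ?T = "prod_topology ?I (prod_topology ?S X)"
  obtain h where h: "continuous_map (prod_topology ?I X) Y h"
    and h0: "\<And>x. x \<in> topspace X \<Longrightarrow> h (0, x) = F (sphere_point, x)"
    and h1: "\<And>x. x \<in> topspace X \<Longrightarrow> h (1, x) = f x"
    and hb: "\<And>t. t \<in> {0..1} \<Longrightarrow> h (t, x0) = y0"
    using hom unfolding pointed_homotopic_iff[OF x0] by auto
  obtain r where r: "continuous_map (prod_topology ?I ?S) ?S r"
    and r0: "\<And>b. b \<in> topspace ?S \<Longrightarrow> r (0, b) = b"
    and r1: "\<And>t b. \<lbrakk>t \<in> {0..1}; b \<in> topspace ?S; 2 * t * b 0 \<ge> 1\<rbrakk> \<Longrightarrow> r (t, b) = sphere_point"
    and r2: "\<And>t. r (t, sphere_point) = sphere_point"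
    by (rule sphere_pushing_homotopy[of n]) (rule that)
  define u :: "real \<times> (nat \<Rightarrow> real) \<times> 'a \<Rightarrow> real" where "u \<equiv> \<lambda>p. 2 * fst p * fst (snd p) 0"
  define H where "H \<equiv> \<lambda>p. if u p \<le> 1 then F (r (fst p, fst (snd p)), snd (snd p))
                              else h (u p - 1, snd (snd p))"
  have F': "continuous_map (prod_topology ?S X) Y F" and Fb: "F (sphere_point, x0) = y0"
    using F by (auto simp: pointed_map_def)
  have t: "continuous_map ?T ?I fst" by (rule continuous_map_fst)
  have t': "continuous_map ?T euclideanreal fst"
    using t continuous_map_in_subtopology by blast
  have b: "continuous_map ?T ?S (\<lambda>p. fst (snd p))" and x: "continuous_map ?T X (\<lambda>p. snd (snd p))"
    using continuous_map_compose[OF continuous_map_snd continuous_map_fst]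
      continuous_map_compose[OF continuous_map_snd continuous_map_snd]
    by (simp_all add: o_def)
  have b0: "continuous_map ?T euclideanreal (\<lambda>p. fst (snd p) 0)"
    using continuous_map_compose[OF b continuous_map_nsphere_projection] by (simp add: o_def)
  have u: "continuous_map ?T euclideanreal u"
    unfolding u_def by (intro continuous_intros t' b0)
  have b_le: "b 0 \<le> 1" if "b \<in> topspace ?S" for b
  proof -
    have "(b 0)\<^sup>2 \<le> (\<Sum>i\<le>n. (b i)\<^sup>2)" by (intro member_le_sum) auto
    then have "(b 0)\<^sup>2 \<le> 1" using that by (simp add: nsphere)
    then show ?thesis by (simp add: abs_square_le_1 abs_le_iff)
  qed
  have u_le: "u p - 1 \<le> 1" if "p \<in> topspace ?T" for p
  proof -
    have "fst p \<in> {0..1}" "fst (snd p) \<in> topspace ?S" using that by auto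
    then have "fst p * fst (snd p) 0 \<le> 1"
      using mult_left_mono[OF b_le, of "fst (snd p)" "fst p"] by simp
    then show ?thesis by (simp add: u_def)
  qed
  have H: "continuous_map ?T Y H"
    unfolding H_def
  proof (rule continuous_map_cases_le)
    have "continuous_map ?T ?S (\<lambda>p. r (fst p, fst (snd p)))"
      using continuous_map_compose[OF continuous_map_pairedI[OF t b] r] by (simp add: o_def)
    then have "continuous_map ?T Y (\<lambda>p. F (r (fst p, fst (snd p)), snd (snd p)))"
      using continuous_map_compose[OF continuous_map_pairedI[OF _ x] F'] by (simp add: o_def)
    then show "continuous_map (subtopology ?T {p \<in> topspace ?T. u p \<le> 1}) Y
        (\<lambda>p. F (r (fst p, fst (snd p)), snd (snd p)))"
      by (rule continuous_map_from_subtopology)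
    let ?R = "subtopology ?T {p \<in> topspace ?T. 1 \<le> u p}"
    have "continuous_map ?R euclideanreal (\<lambda>p. u p - 1)"
      by (intro continuous_intros continuous_map_from_subtopology u) auto
    then have "continuous_map ?R ?I (\<lambda>p. u p - 1)"
      using u_le by (auto simp: continuous_map_in_subtopology)
    moreover have "continuous_map ?R X (\<lambda>p. snd (snd p))"
      by (rule continuous_map_from_subtopology[OF x])
    ultimately show "continuous_map ?R Y (\<lambda>p. h (u p - 1, snd (snd p)))"
      using continuous_map_compose[OF continuous_map_pairedI h] by (simp add: o_def)
  next
    fix p assume p: "p \<in> topspace ?T" and "u p = 1"
    then show "F (r (fst p, fst (snd p)), snd (snd p)) = h (u p - 1, snd (snd p))"
      using h0 by (auto simp: r1 u_def)
  qed (use u in auto)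
  define G where "G \<equiv> \<lambda>q. H (1, q)"
  have base: "H (t, sphere_point, x0) = y0" if "t \<in> {0..1}" for t
    using that hb Fb by (auto simp: H_def u_def r2 sphere_point_def[THEN fun_cong, of 0])
  have H0: "H (0, q) = F q" if "q \<in> topspace (prod_topology ?S X)" for q
    using that by (auto simp: H_def u_def r0)
  have "pointed_homotopic (prod_topology ?S X) (sphere_point, x0) Y y0 F G"
    using H base H0 x0 by (subst pointed_homotopic_iff) (auto simp: G_def intro!: exI[of _ H])
  moreover have "G (sphere_point, x) = f x" if "x \<in> topspace X" for x
    using h1 that by (simp add: G_def H_def u_def sphere_point_def[THEN fun_cong, of 0])
  ultimately show thesis by (rule that)
qed

section \<open>Evaluation on homotopy classes\<close>

lemma homotopy_group_iff:
  "a \<in> homotopy_group n Y y0 \<longleftrightarrow>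
    (\<exists>\<alpha>. pointed_map (nsphere n) sphere_point Y y0 \<alpha> \<and>
      a = {\<beta>. pointed_homotopic (nsphere n) sphere_point Y y0 \<alpha> \<beta>})"
  by (auto simp: homotopy_group_def quotient_def)

lemma homotopy_group_class_eq:
  assumes "a \<in> homotopy_group n Y y0" "\<alpha> \<in> a"
  shows "a = {\<beta>. pointed_homotopic (nsphere n) sphere_point Y y0 \<alpha> \<beta>}"
  using assms unfolding homotopy_group_iff
  by (blast intro: pointed_homotopic_sym pointed_homotopic_trans)

lemma evaluation_compose_continuous:
  assumes g: "continuous_map C (prod_topology (map_component X Y f) X) g"
    and C: "compact_space C" "Hausdorff_space C"
    and X: "k_space X" "Hausdorff_space X"
  shows "continuous_map C Y (evaluation \<circ> g)"
proof -
  have g1: "continuous_map C (map_space X Y) (fst \<circ> g)" and g2: "continuous_map C X (snd \<circ> g)"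
    using g continuous_map_pairwise[of C _ _ g]
    by (auto simp: map_component_def continuous_map_in_subtopology)
  have "continuous_map C (prod_topology C X) (\<lambda>c. (c, snd (g c)))"
    using g2 by (simp add: continuous_map_pairedI o_def)
  from continuous_map_compose[OF this continuous_map_uncurry[OF g1 C X]] show ?thesis
    by (simp add: evaluation_def o_def case_prod_unfold)
qed

lemma evaluation_preserves_pointed_homotopy:
  assumes hom: "pointed_homotopic S s0 (prod_topology (map_component X Y f) X)
      (restrict f (topspace X), x0) \<alpha> \<beta>"
    and S: "compact_space S" "Hausdorff_space S" "s0 \<in> topspace S"
    and X: "k_space X" "Hausdorff_space X" "x0 \<in> topspace X" and fx: "f x0 = y0"
  shows "pointed_homotopic S s0 Y y0 (evaluation \<circ> \<alpha>) (evaluation \<circ> \<beta>)"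
proof -
  let ?I = "top_of_set {0..1::real}"
  obtain h where h: "continuous_map (prod_topology ?I S) (prod_topology (map_component X Y f) X) h"
    and h0: "\<forall>x\<in>topspace S. h (0, x) = \<alpha> x" and h1: "\<forall>x\<in>topspace S. h (1, x) = \<beta> x"
    and hb: "\<forall>t\<in>{0..1}. h (t, s0) = (restrict f (topspace X), x0)"
    using hom unfolding pointed_homotopic_iff[OF S(3)] by auto
  have "compact_space (prod_topology ?I S)" "Hausdorff_space (prod_topology ?I S)"
    using S by (simp_all add: compact_space_prod_topology Hausdorff_space_prod_topology
        compact_space_subtopology Hausdorff_space_subtopology)
  then have "continuous_map (prod_topology ?I S) Y (evaluation \<circ> h)"
    using evaluation_compose_continuous[OF h] X by blast
  then show ?thesis
    unfolding pointed_homotopic_iff[OF S(3)] using h0 h1 hb X(3) fx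
    by (intro exI[of _ "evaluation \<circ> h"]) (auto simp: evaluation_def)
qed

text \<open>The induced map is defined as a union over all representatives, so a single representative
  suffices only because homotopic maps have homotopic evaluations.\<close>

lemma homotopy_group_map_evaluation_class:
  assumes \<alpha>: "pointed_map (nsphere n) sphere_point (prod_topology (map_component X Y f) X)
      (restrict f (topspace X), x0) \<alpha>"
    and X: "k_space X" "Hausdorff_space X" "x0 \<in> topspace X" and fx: "f x0 = y0"
  shows "homotopy_group_map n Y y0 evaluation
      {\<beta>. pointed_homotopic (nsphere n) sphere_point (prod_topology (map_component X Y f) X)
        (restrict f (topspace X), x0) \<alpha> \<beta>}
    = {\<beta>. pointed_homotopic (nsphere n) sphere_point Y y0 (evaluation \<circ> \<alpha>) \<beta>}"
proof -
  have ev: "pointed_homotopic (nsphere n) sphere_point Y y0 (evaluation \<circ> \<alpha>) (evaluation \<circ> \<beta>)"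
    if "pointed_homotopic (nsphere n) sphere_point (prod_topology (map_component X Y f) X)
        (restrict f (topspace X), x0) \<alpha> \<beta>" for \<beta>
    by (rule evaluation_preserves_pointed_homotopy[where f = f, OF that compact_space_nsphere Hausdorff_space_nsphere
          sphere_point_in_nsphere X fx])
  show ?thesis
    unfolding homotopy_group_map_def
    using ev pointed_homotopic_refl[OF \<alpha>]
    by (blast intro: pointed_homotopic_trans pointed_homotopic_sym)
qed

section \<open>Comparison of the two subsets\<close>

lemma relaxed_evaluation_subgroup_evaluation:
  assumes \<alpha>: "pointed_map (nsphere n) sphere_point (prod_topology (map_component X Y f) X)
      (restrict f (topspace X), x0) \<alpha>"
    and X: "k_space X" "Hausdorff_space X" "x0 \<in> topspace X"
    and f: "pointed_map X x0 Y y0 f"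
  shows "{\<beta>. pointed_homotopic (nsphere n) sphere_point Y y0 (evaluation \<circ> \<alpha>) \<beta>}
    \<in> relaxed_evaluation_subgroup n Y y0 X x0 f"
proof -
  let ?S = "nsphere n"
  define s where "s \<equiv> \<lambda>b. (b, snd (\<alpha> b))"
  define F where "F \<equiv> \<lambda>(b, x). fst (\<alpha> b) x"
  have fx: "f x0 = y0" and fc: "continuous_map X Y f" using f by (auto simp: pointed_map_def)
  have \<alpha>c: "continuous_map ?S (prod_topology (map_component X Y f) X) \<alpha>"
    and \<alpha>b: "\<alpha> sphere_point = (restrict f (topspace X), x0)"
    using \<alpha> by (auto simp: pointed_map_def)
  have \<alpha>1: "continuous_map ?S (map_space X Y) (\<lambda>b. fst (\<alpha> b))"
    and \<alpha>2: "continuous_map ?S X (\<lambda>b. snd (\<alpha> b))"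
    using \<alpha>c continuous_map_pairwise[of ?S _ _ \<alpha>]
    by (auto simp: map_component_def continuous_map_in_subtopology o_def)
  have Fc: "continuous_map (prod_topology ?S X) Y F"
    using continuous_map_uncurry[OF \<alpha>1 compact_space_nsphere Hausdorff_space_nsphere X(1,2)]
    by (simp add: F_def)
  have Fp: "pointed_map (prod_topology ?S X) (sphere_point, x0) Y y0 F"
    using Fc X(3) fx by (simp add: pointed_map_def F_def \<alpha>b)
  have sp: "pointed_map ?S sphere_point (prod_topology ?S X) (sphere_point, x0) s"
    using \<alpha>2 by (simp add: pointed_map_def s_def \<alpha>b continuous_map_pairedI)
  have "fst \<circ> s = id" by (auto simp: s_def)
  then have sec: "pointed_section ?S sphere_point X x0 s"
    using sp by (simp add: pointed_section_def pointed_homotopic_refl pointed_map_def)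
  have Fs: "F \<circ> s = evaluation \<circ> \<alpha>"
    by (auto simp: F_def s_def evaluation_def case_prod_unfold)
  have \<gamma>: "pointed_map ?S sphere_point Y y0 (evaluation \<circ> \<alpha>)"
    using pointed_map_compose[OF sp Fp] by (simp add: Fs)
  \<comment> \<open>\<open>F\<close> on the slice is the restriction of \<open>f\<close>, which differs from \<open>f\<close> outside \<open>topspace X\<close>.\<close>
  have "pointed_homotopic X x0 Y y0 f (F \<circ> (\<lambda>x. (sphere_point, x)))"
    using f X(3) by (rule pointed_homotopic_equal) (simp add: F_def \<alpha>b)
  then have "pointed_homotopic X x0 Y y0 (F \<circ> (\<lambda>x. (sphere_point, x))) f"
    by (rule pointed_homotopic_sym)
  then show ?thesis
    unfolding relaxed_evaluation_subgroup_def homotopy_group_iff mem_Collect_eq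
    using sec Fp Fs \<gamma> pointed_homotopic_refl[OF \<gamma>]
    by (intro conjI exI[of _ s] exI[of _ F] exI[of _ "evaluation \<circ> \<alpha>"]) auto
qed

text \<open>Both homotopies in the definition of the subgroup are made strict: \<open>F\<close> is deformed to a map
  \<open>G\<close> that equals \<open>f\<close> on the slice, and \<open>s\<close> to a section \<open>s'\<close> whose first component is the
  identity. The pair of the curried \<open>G\<close> and the second component of \<open>s\<close> is the required \<open>\<alpha>\<close>.\<close>

lemma relaxed_evaluation_subgroup_factorization:
  assumes a: "a \<in> relaxed_evaluation_subgroup n Y y0 X x0 f"
    and x0: "x0 \<in> topspace X" and f: "pointed_map X x0 Y y0 f" and n: "n \<ge> 1"
  obtains \<alpha> where
    "pointed_map (nsphere n) sphere_point (prod_topology (map_component X Y f) X)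
      (restrict f (topspace X), x0) \<alpha>"
    "a = {\<beta>. pointed_homotopic (nsphere n) sphere_point Y y0 (evaluation \<circ> \<alpha>) \<beta>}"
proof -
  let ?S = "nsphere n"
  obtain s F where ah: "a \<in> homotopy_group n Y y0" and sec: "pointed_section ?S sphere_point X x0 s"
    and F: "pointed_map (prod_topology ?S X) (sphere_point, x0) Y y0 F"
    and Fs: "F \<circ> s \<in> a"
    and Fi: "pointed_homotopic X x0 Y y0 (F \<circ> (\<lambda>x. (sphere_point, x))) f"
    using a unfolding relaxed_evaluation_subgroup_def by blast
  obtain G where FG: "pointed_homotopic (prod_topology ?S X) (sphere_point, x0) Y y0 F G"
    and Gf: "\<And>x. x \<in> topspace X \<Longrightarrow> G (sphere_point, x) = f x"
    using homotopy_extension_sphere_slice[OF F Fi x0] by blast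
  have G: "pointed_map (prod_topology ?S X) (sphere_point, x0) Y y0 G"
    using pointed_homotopic_imp_pointed_map[OF FG] by blast
  then have Gc: "continuous_map (prod_topology ?S X) Y G" by (simp add: pointed_map_def)
  have s: "pointed_map ?S sphere_point (prod_topology ?S X) (sphere_point, x0) s"
    and s1: "pointed_homotopic ?S sphere_point ?S sphere_point (fst \<circ> s) id"
    using sec by (auto simp: pointed_section_def)
  have s2: "continuous_map ?S X (\<lambda>b. snd (s b))" and sb: "s sphere_point = (sphere_point, x0)"
    using s continuous_map_pairwise[of ?S _ _ s] by (auto simp: pointed_map_def o_def)
  define s' where "s' \<equiv> \<lambda>b. (b, snd (s b))"
  \<comment> \<open>The second component is constant in time, so the base point stays at \<open>(*, x0)\<close>.\<close>
  have ss': "pointed_homotopic ?S sphere_point (prod_topology ?S X) (sphere_point, x0) s s'"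
  proof -
    let ?I = "top_of_set {0..1::real}"
    obtain k where k: "continuous_map (prod_topology ?I ?S) ?S k"
      and k0: "\<And>b. b \<in> topspace ?S \<Longrightarrow> k (0, b) = fst (s b)"
      and k1: "\<And>b. b \<in> topspace ?S \<Longrightarrow> k (1, b) = b"
      and kb: "\<And>t. t \<in> {0..1} \<Longrightarrow> k (t, sphere_point) = sphere_point"
      using s1 unfolding pointed_homotopic_iff[OF sphere_point_in_nsphere] by auto
    have "continuous_map (prod_topology ?I ?S) X (\<lambda>p. snd (s (snd p)))"
      using continuous_map_compose[OF continuous_map_snd s2] by (simp add: o_def)
    with k have "continuous_map (prod_topology ?I ?S) (prod_topology ?S X) (\<lambda>p. (k p, snd (s (snd p))))"
      by (rule continuous_map_pairedI)
    then show ?thesis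
      unfolding pointed_homotopic_iff[OF sphere_point_in_nsphere]
      using k0 k1 kb sb by (intro exI[of _ "\<lambda>p. (k p, snd (s (snd p)))"]) (auto simp: s'_def)
  qed
  have "pointed_homotopic ?S sphere_point Y y0 (F \<circ> s) (G \<circ> s)"
    using FG s by (rule pointed_homotopic_compose_right)
  moreover have "pointed_homotopic ?S sphere_point Y y0 (G \<circ> s) (G \<circ> s')"
    using ss' G by (rule pointed_homotopic_compose_left)
  ultimately have hom: "pointed_homotopic ?S sphere_point Y y0 (F \<circ> s) (G \<circ> s')"
    by (rule pointed_homotopic_trans)
  define \<alpha>1 where "\<alpha>1 \<equiv> \<lambda>b. restrict (\<lambda>x. G (b, x)) (topspace X)"
  define \<alpha> where "\<alpha> \<equiv> \<lambda>b. (\<alpha>1 b, snd (s b))"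
  have \<alpha>1: "continuous_map ?S (map_space X Y) \<alpha>1"
    unfolding \<alpha>1_def by (rule continuous_map_curry[OF Gc])
  have \<alpha>1b: "\<alpha>1 sphere_point = restrict f (topspace X)"
    using Gf by (auto simp: \<alpha>1_def)
  have "connectedin (map_space X Y) (\<alpha>1 ` topspace ?S)"
    using connected_space_nsphere[OF n] \<alpha>1
    by (simp add: connectedin_continuous_map_image connectedin_topspace)
  moreover have "restrict f (topspace X) \<in> \<alpha>1 ` topspace ?S"
    using \<alpha>1b sphere_point_in_nsphere by (metis imageI)
  ultimately have "\<alpha>1 ` topspace ?S \<subseteq>
      connected_component_of_set (map_space X Y) (restrict f (topspace X))"
    by (rule connected_component_of_maximal)
  then have "continuous_map ?S (map_component X Y f) \<alpha>1"
    unfolding map_component_def using \<alpha>1 by (intro continuous_map_into_subtopology) auto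
  then have \<alpha>: "pointed_map ?S sphere_point (prod_topology (map_component X Y f) X)
      (restrict f (topspace X), x0) \<alpha>"
    using s2 by (simp add: \<alpha>_def pointed_map_def continuous_map_pairedI \<alpha>1b sb)
  have "pointed_homotopic ?S sphere_point Y y0 (G \<circ> s') (evaluation \<circ> \<alpha>)"
  proof (rule pointed_homotopic_equal)
    show "pointed_map ?S sphere_point Y y0 (G \<circ> s')"
      using pointed_homotopic_imp_pointed_map[OF hom] by blast
    fix b assume "b \<in> topspace ?S"
    then have "snd (s b) \<in> topspace X"
      using s2 by (auto simp: continuous_map_def Pi_iff)
    then show "(G \<circ> s') b = (evaluation \<circ> \<alpha>) b"
      by (simp add: s'_def \<alpha>_def \<alpha>1_def evaluation_def)
  qed simp
  with hom have "pointed_homotopic ?S sphere_point Y y0 (F \<circ> s) (evaluation \<circ> \<alpha>)"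
    by (rule pointed_homotopic_trans)
  then have "evaluation \<circ> \<alpha> \<in> a"
    using homotopy_group_class_eq[OF ah Fs] by simp
  then show thesis
    using that[OF \<alpha>] homotopy_group_class_eq[OF ah] by blast
qed

theorem mainTheorem1:
  fixes X :: "'a topology" and Y :: "'b topology" and f :: "'a \<Rightarrow> 'b"
    and x0 :: 'a and y0 :: 'b and n :: nat
  assumes "CW_complex X" and "connected_space X" and "x0 \<in> topspace X"
    and "CW_complex Y" and "connected_space Y" and "y0 \<in> topspace Y"
    and "pointed_map X x0 Y y0 f"
    and "n \<ge> 1"
  shows "relaxed_evaluation_subgroup n Y y0 X x0 f =
    homotopy_group_map n Y y0 evaluation `
      homotopy_group n (prod_topology (map_component X Y f) X) (restrict f (topspace X), x0)"
proof -
  note X = CW_complex_Hausdorff_k_space(2,1)[OF assms(1)] assms(3)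
  have fx: "f x0 = y0" using assms(7) by (simp add: pointed_map_def)
  show ?thesis
  proof (intro set_eqI iffI)
    fix a assume "a \<in> relaxed_evaluation_subgroup n Y y0 X x0 f"
    then obtain \<alpha> where \<alpha>: "pointed_map (nsphere n) sphere_point (prod_topology (map_component X Y f) X)
        (restrict f (topspace X), x0) \<alpha>"
      and a: "a = {\<beta>. pointed_homotopic (nsphere n) sphere_point Y y0 (evaluation \<circ> \<alpha>) \<beta>}"
      by (rule relaxed_evaluation_subgroup_factorization[OF _ assms(3,7,8)])
    show "a \<in> homotopy_group_map n Y y0 evaluation `
        homotopy_group n (prod_topology (map_component X Y f) X) (restrict f (topspace X), x0)"
      unfolding a homotopy_group_map_evaluation_class[where f = f, OF \<alpha> X fx, symmetric]
      using \<alpha> by (intro imageI) (auto simp only: homotopy_group_iff)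
  next
    fix a assume "a \<in> homotopy_group_map n Y y0 evaluation `
        homotopy_group n (prod_topology (map_component X Y f) X) (restrict f (topspace X), x0)"
    then obtain c where a: "a = homotopy_group_map n Y y0 evaluation c"
      and "c \<in> homotopy_group n (prod_topology (map_component X Y f) X) (restrict f (topspace X), x0)"
      by (rule imageE)
    then obtain \<alpha> where \<alpha>: "pointed_map (nsphere n) sphere_point (prod_topology (map_component X Y f) X)
        (restrict f (topspace X), x0) \<alpha>"
      and c: "c = {\<beta>. pointed_homotopic (nsphere n) sphere_point (prod_topology (map_component X Y f) X)
          (restrict f (topspace X), x0) \<alpha> \<beta>}"
      unfolding homotopy_group_iff by (elim exE conjE)
    show "a \<in> relaxed_evaluation_subgroup n Y y0 X x0 f"
      unfolding a c homotopy_group_map_evaluation_class[where f = f, OF \<alpha> X fx]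
      by (rule relaxed_evaluation_subgroup_evaluation[OF \<alpha> X assms(7)])
  qed
qed

end
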